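(* Let $n\ge 1$ and let the two colors of $C_2$ be $a$ and $b$. There is a bijection between $\Pi_n^{eq}\wr C_2(1^a2^a)$ and the set of set partitions of $[n+3]$ which have at least one singleton block and in which the largest element forming a singleton block is $n+1$.
   Context: $\Pi_n\wr C_2$ denotes the set of colored set partitions of $[n]$: pairs consisting of a set partition of $[n]$ and an assignment of one of two colors $a,b$ to each element. A colored partition eq-contains $1^a2^a$ if there are elements $x<y$ in different blocks both colored $a$; $\Pi_n^{eq}\wr C_2(1^a2^a)$ is the set of colored partitions that do not (i.e. all $a$-colored elements lie in a single block). *)

theory Defs
  imports "HOL-Library.Disjoint_Sets" "HOL-Library.FuncSet"
begin

datatype color = Col_a | Col_b

text \<open>Colorings are extensional functions on \<open>{1..n}\<close>, so that distinct pairs represent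
  distinct colored partitions.\<close>

definition colored_partitions :: "nat \<Rightarrow> (nat set set \<times> (nat \<Rightarrow> color)) set" where
  "colored_partitions n =
     {(P, c). partition_on {1..n} P \<and> c \<in> {1..n} \<rightarrow>\<^sub>E (UNIV :: color set)}"

definition eq_contains_1a2a :: "nat set set \<times> (nat \<Rightarrow> color) \<Rightarrow> bool" where
  "eq_contains_1a2a = (\<lambda>(P, c).
     \<exists>X\<in>P. \<exists>Y\<in>P. X \<noteq> Y \<and> (\<exists>x\<in>X. \<exists>y\<in>Y. x < y \<and> c x = Col_a \<and> c y = Col_a))"

definition eq_avoiders_1a2a :: "nat \<Rightarrow> (nat set set \<times> (nat \<Rightarrow> color)) set" where
  "eq_avoiders_1a2a n = {p \<in> colored_partitions n. \<not> eq_contains_1a2a p}"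

definition singleton_elements :: "nat set set \<Rightarrow> nat set" where
  "singleton_elements P = {k. {k} \<in> P}"

definition partitions_max_singleton :: "nat \<Rightarrow> nat \<Rightarrow> nat set set set" where
  "partitions_max_singleton m k =
     {P. partition_on {1..m} P \<and> singleton_elements P \<noteq> {} \<and> Max (singleton_elements P) = k}"

end

theory Submission
  imports Defs
begin

text \<open>
  Both sides are encoded by triples \<open>(S, T, R)\<close>, where \<open>S\<close> and \<open>T\<close> are disjoint subsets of \<open>[n]\<close>,
  \<open>T\<close> is empty whenever \<open>S\<close> is, and \<open>R\<close> partitions the rest of \<open>[n]\<close>.
  An avoiding colored partition gives such a triple: \<open>S\<close> is the set of \<open>a\<close>-colored elements, \<open>T\<close> the
  set of \<open>b\<close>-colored elements in the block of \<open>S\<close>, and \<open>R\<close> consists of the other blocks.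
  On the other side, put \<open>u = n + 2\<close> and \<open>v = n + 3\<close>. Having largest singleton \<open>n + 1\<close> means that
  \<open>{n + 1}\<close> is a block while \<open>{u}\<close> and \<open>{v}\<close> are not. Here the triple is represented by the blocks
  \<open>S \<union> {u}\<close> and \<open>T \<union> {v}\<close> if \<open>T\<close> is nonempty, and by the single block \<open>S \<union> {u, v}\<close> otherwise.
\<close>

definition split_partitions :: "'a set \<Rightarrow> ('a set \<times> 'a set \<times> 'a set set) set" where
  "split_partitions A = {(S, T, R). S \<subseteq> A \<and> T \<subseteq> A \<and> S \<inter> T = {} \<and> (S = {} \<longrightarrow> T = {}) \<and>
     partition_on (A - (S \<union> T)) R}"

lemma bij_betw_inverseI:
  assumes "\<And>x. x \<in> A \<Longrightarrow> f x \<in> B \<and> g (f x) = x" and "\<And>y. y \<in> B \<Longrightarrow> g y \<in> A \<and> f (g y) = y"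
  shows "bij_betw f A B"
  by (rule bij_betw_byWitness[where f' = g]) (use assms in auto)

section \<open>Avoiding colored partitions as triples\<close>

lemma eq_contains_1a2a_iff:
  assumes "partition_on A P"
  shows "eq_contains_1a2a (P, c) \<longleftrightarrow>
    (\<exists>X\<in>P. \<exists>Y\<in>P. X \<noteq> Y \<and> (\<exists>x\<in>X. c x = Col_a) \<and> (\<exists>y\<in>Y. c y = Col_a))"
proof
  assume "\<exists>X\<in>P. \<exists>Y\<in>P. X \<noteq> Y \<and> (\<exists>x\<in>X. c x = Col_a) \<and> (\<exists>y\<in>Y. c y = Col_a)"
  then obtain X Y x y where xy: "X \<in> P" "Y \<in> P" "X \<noteq> Y" "x \<in> X" "y \<in> Y" "c x = Col_a" "c y = Col_a"
    by blast
  \<comment> \<open>Distinct blocks are disjoint, so the witnesses differ. If \<open>y < x\<close>,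
    the two blocks swap roles, as the pattern gives both elements the same color.\<close>
  then have "x \<noteq> y"
    using assms by (metis disjointD disjoint_iff partition_onD2)
  with xy show "eq_contains_1a2a (P, c)"
    unfolding eq_contains_1a2a_def prod.case by (metis linorder_less_linear)
qed (auto simp: eq_contains_1a2a_def)

text \<open>Avoidance puts \<open>S\<close> inside one block, so the union of the blocks meeting
  \<open>S\<close> is that block, or empty if \<open>S\<close> is. This avoids choosing a block. The
  coloring is recovered from \<open>S\<close>, since there are only two colors.\<close>

lemma bij_betw_eq_avoiders_1a2a:
  "bij_betw
     (\<lambda>(P, c). let S = {x \<in> {1..n}. c x = Col_a}
               in (S, \<Union>{X \<in> P. X \<inter> S \<noteq> {}} - S, {X \<in> P. X \<inter> S = {}}))
     (eq_avoiders_1a2a n) (split_partitions {1..n})"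
  (is "bij_betw ?f _ _")
proof -
  \<comment> \<open>Subtracting \<open>{{}}\<close> covers \<open>S = {}\<close>: then
    \<open>T = {}\<close> too, and the empty set must not become a block. The restricted \<lambda>
    keeps the coloring extensional.\<close>
  define g :: "nat set \<times> nat set \<times> nat set set \<Rightarrow> nat set set \<times> (nat \<Rightarrow> color)" where
    "g = (\<lambda>(S, T, R). (R \<union> ({S \<union> T} - {{}}), \<lambda>x\<in>{1..n}. if x \<in> S then Col_a else Col_b))"
  have f: "?f (P, c) \<in> split_partitions {1..n} \<and> g (?f (P, c)) = (P, c)"
    if "(P, c) \<in> eq_avoiders_1a2a n" for P c
  proof -
    define S where "S = {x \<in> {1..n}. c x = Col_a}"
    have fP: "?f (P, c) = (S, \<Union>{X \<in> P. X \<inter> S \<noteq> {}} - S, {X \<in> P. X \<inter> S = {}})"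
      by (simp only: prod.case Let_def S_def)
    have P: "partition_on {1..n} P" and c: "c \<in> {1..n} \<rightarrow>\<^sub>E UNIV"
      and av: "\<not> eq_contains_1a2a (P, c)"
      using that by (auto simp: eq_avoiders_1a2a_def colored_partitions_def)
    have U: "\<Union>P = {1..n}" and ne: "{} \<notin> P" and disj: "disjoint P"
      using P by (auto simp: partition_on_def)
    have col: "(\<lambda>x\<in>{1..n}. if x \<in> S then Col_a else Col_b) = c"
    proof
      fix x
      show "(\<lambda>x\<in>{1..n}. if x \<in> S then Col_a else Col_b) x = c x"
        using c by (cases "c x") (auto simp: S_def PiE_def extensional_def)
    qed
    have uniq: "X = Y" if "X \<in> P" "Y \<in> P" "X \<inter> S \<noteq> {}" "Y \<inter> S \<noteq> {}" for X Y
      using av that unfolding eq_contains_1a2a_iff[OF P] S_def by blast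
    have SU: "S \<subseteq> \<Union>P" using U by (auto simp: S_def)
    show ?thesis
    \<comment> \<open>Without an a-colored element the triple is \<open>({}, {}, P)\<close>;
      otherwise exactly one block \<open>B\<close> meets \<open>S\<close>, and it contains
      \<open>S\<close>.\<close>
    proof (cases "S = {}")
      case True
      then show ?thesis
        using P col unfolding fP by (simp add: split_partitions_def g_def)
    next
      case False
      then obtain B where B: "B \<in> P" "B \<inter> S \<noteq> {}" using SU by blast
      have only: "X = B" if "X \<in> P" "X \<inter> S \<noteq> {}" for X
        using uniq that B by blast
      have "S \<subseteq> B" using SU only by blast
      have 1: "{X \<in> P. X \<inter> S \<noteq> {}} = {B}" using B only by blast
      have 2: "{X \<in> P. X \<inter> S = {}} = P - {B}" using B only by blast
      have "partition_on ({1..n} - B) (P - {B})"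
        using B U ne disj
        by (auto simp: partition_on_def disjoint_def)
      moreover have "S \<union> (B - S) = B" using \<open>S \<subseteq> B\<close> by blast
      moreover have "B \<subseteq> {1..n}" using B U by blast
      moreover have "P - {B} \<union> ({B} - {{}}) = P" using B ne by blast
      ultimately show ?thesis
        using \<open>S \<subseteq> B\<close> False col unfolding fP
        by (auto simp: split_partitions_def g_def 1 2)
    qed
  qed
  have g: "g (S, T, R) \<in> eq_avoiders_1a2a n \<and> ?f (g (S, T, R)) = (S, T, R)"
    if "(S, T, R) \<in> split_partitions {1..n}" for S T R
  proof -
    define c where "c = (\<lambda>x\<in>{1..n}. if x \<in> S then Col_a else Col_b)"
    define P where "P = R \<union> ({S \<union> T} - {{}})"
    have ST: "S \<subseteq> {1..n}" "T \<subseteq> {1..n}" "S \<inter> T = {}" "S = {} \<Longrightarrow> T = {}"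
      and R: "partition_on ({1..n} - (S \<union> T)) R"
      using that by (auto simp: split_partitions_def)
    have U: "\<Union>R = {1..n} - (S \<union> T)"
      using R by (auto simp: partition_on_def)
    have gP: "g (S, T, R) = (P, c)" by (simp add: g_def P_def c_def)
    have S: "{x \<in> {1..n}. c x = Col_a} = S"
      using ST(1) by (auto simp: c_def)
    have P: "partition_on {1..n} P"
    proof (cases "S = {}")
      case True
      then show ?thesis using R ST(4) by (simp add: P_def)
    next
      case False
      then have "P = insert (S \<union> T) R" by (auto simp: P_def)
      moreover have "disjnt (S \<union> T) (\<Union>R)" using U by (auto simp: disjnt_iff)
      ultimately show ?thesis using R ST(1,2) False by (simp add: partition_on_insert)
    qed
    have RS: "X \<inter> S = {}" if "X \<in> R" for X using U that by blast
    have c: "c \<in> {1..n} \<rightarrow>\<^sub>E UNIV" by (auto simp: c_def)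
    \<comment> \<open>The blocks of \<open>R\<close> miss \<open>S\<close>, so only
      \<open>S \<union> T\<close> can hold a-colored elements; this gives avoidance.\<close>
    have "X = S \<union> T" if "X \<in> P" "x \<in> X" "c x = Col_a" for X x
    proof -
      have "x \<in> {1..n}" using P that by (auto simp: partition_on_def)
      then have "x \<in> S" using that S by blast
      then show ?thesis using that RS by (auto simp: P_def)
    qed
    then have "\<not> eq_contains_1a2a (P, c)"
      unfolding eq_contains_1a2a_iff[OF P] by metis
    then have "(P, c) \<in> eq_avoiders_1a2a n"
      using P c by (simp add: eq_avoiders_1a2a_def colored_partitions_def)
    \<comment> \<open>If \<open>S\<close> is empty, no block meets it and the union is empty, which
      agrees with \<open>T\<close> only because \<open>T\<close> is then empty as well.\<close>
    moreover have "\<Union>{X \<in> P. X \<inter> S \<noteq> {}} - S = T"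
    proof (cases "S = {}")
      case False
      then have "{X \<in> P. X \<inter> S \<noteq> {}} = {S \<union> T}" using RS unfolding P_def by blast
      then show ?thesis using ST(3) by auto
    qed (simp add: ST(4))
    moreover have "{X \<in> P. X \<inter> S = {}} = R"
      using ST(4) RS unfolding P_def by blast
    ultimately show ?thesis unfolding gP prod.case Let_def S by simp
  qed
  show ?thesis
  proof (rule bij_betw_inverseI[where g = g])
    fix p assume "p \<in> eq_avoiders_1a2a n"
    then show "?f p \<in> split_partitions {1..n} \<and> g (?f p) = p" by (cases p) (simp only: f)
  next
    fix q assume "q \<in> split_partitions {1..n}"
    then show "g q \<in> eq_avoiders_1a2a n \<and> ?f (g q) = q" by (cases q) (simp only: g)
  qed
qed

section \<open>Partitions with two extra non-singleton points as triples\<close>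

lemma bij_betw_split_partitions:
  assumes uv: "u \<notin> A" "v \<notin> A" "u \<noteq> v"
  shows "bij_betw
     (\<lambda>(S, T, R). R \<union> (if T = {} then {insert u (insert v S)} else {insert u S, insert v T}))
     (split_partitions A)
     {Q. partition_on (insert u (insert v A)) Q \<and> {u} \<notin> Q \<and> {v} \<notin> Q}"
  (is "bij_betw ?f _ ?B")
proof -
  \<comment> \<open>One formula serves both cases: if \<open>u\<close> and \<open>v\<close> share a
    block, subtracting \<open>S\<close> leaves \<open>T = {}\<close>; if not, their blocks are
    disjoint and the subtraction changes nothing.\<close>
  define g where "g = (\<lambda>Q. let S = \<Union>{X \<in> Q. u \<in> X} \<inter> A
    in (S, \<Union>{X \<in> Q. v \<in> X} \<inter> A - S, {X \<in> Q. X \<subseteq> A}))"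
  have f: "?f (S, T, R) \<in> ?B \<and> g (?f (S, T, R)) = (S, T, R)"
    if "(S, T, R) \<in> split_partitions A" for S T R
  proof -
    have ST: "S \<subseteq> A" "T \<subseteq> A" "S \<inter> T = {}" "S = {} \<Longrightarrow> T = {}"
      and R: "partition_on (A - (S \<union> T)) R"
      using that by (auto simp: split_partitions_def)
    have U: "\<Union>R = A - (S \<union> T)"
      using R by (auto simp: partition_on_def)
    have RA: "X \<subseteq> A" "u \<notin> X" "v \<notin> X" "X \<inter> S = {}" "X \<inter> T = {}" if "X \<in> R" for X
      using U uv that by blast+
    have uvST: "u \<notin> S" "v \<notin> S" "u \<notin> T" "v \<notin> T" using uv ST by blast+
    show ?thesis
    proof (cases "T = {}")
      case True
      let ?Q = "insert (insert u (insert v S)) R"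
      have "partition_on (insert u (insert v A)) ?Q"
      proof (subst partition_on_insert)
        show "disjnt (insert u (insert v S)) (\<Union>R)" using U uv by (auto simp: disjnt_iff)
        have "insert u (insert v A) - insert u (insert v S) = A - (S \<union> T)"
          using uv True by blast
        then show "partition_on (insert u (insert v A) - insert u (insert v S)) R \<and>
            insert u (insert v S) \<subseteq> insert u (insert v A) \<and> insert u (insert v S) \<noteq> {}"
          using R ST(1) by auto
      qed
      \<comment> \<open>The new block contains both \<open>u\<close> and \<open>v\<close>, so it is
        no singleton even when \<open>S\<close> is empty.\<close>
      moreover have "{u} \<notin> ?Q" "{v} \<notin> ?Q" using RA uv by blast+
      moreover have "{X \<in> ?Q. u \<in> X} = {insert u (insert v S)}"
        "{X \<in> ?Q. v \<in> X} = {insert u (insert v S)}" "{X \<in> ?Q. X \<subseteq> A} = R"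
        using RA uv by blast+
      moreover have "insert u (insert v S) \<inter> A = S" using uv ST by blast
      ultimately show ?thesis using True by (simp add: g_def)
    next
      case False
      let ?Q = "insert (insert u S) (insert (insert v T) R)"
      have "partition_on (insert u (insert v A)) ?Q"
      proof -
        have "insert u (insert v A) - insert u S - insert v T = A - (S \<union> T)"
          using uv by blast
        moreover have "disjnt (insert u S) (\<Union>(insert (insert v T) R))"
          "disjnt (insert v T) (\<Union>R)"
          using U uv uvST ST(3) by (auto simp: disjnt_iff)
        moreover have "insert v T \<subseteq> insert u (insert v A) - insert u S"
          using ST uv uvST by auto
        ultimately show ?thesis using R ST(1) by (auto simp: partition_on_insert)
      qed
      \<comment> \<open>As \<open>T\<close> is nonempty, so is \<open>S\<close> by the condition on
        triples; hence neither new block is a singleton.\<close>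
      moreover have "{u} \<notin> ?Q" "{v} \<notin> ?Q" using RA uvST uv ST(4) False by blast+
      moreover have "{X \<in> ?Q. u \<in> X} = {insert u S}" "{X \<in> ?Q. v \<in> X} = {insert v T}"
        "{X \<in> ?Q. X \<subseteq> A} = R"
        using RA uv uvST by blast+
      moreover have "insert u S \<inter> A = S" "insert v T \<inter> A = T" "T - S = T" using uv ST by blast+
      moreover have "?f (S, T, R) = ?Q" using False by auto
      ultimately show ?thesis by (simp add: g_def)
    qed
  qed
  have g: "g Q \<in> split_partitions A \<and> ?f (g Q) = Q" if Q: "Q \<in> ?B" for Q
  proof -
    have U: "\<Union>Q = insert u (insert v A)" and ne: "{} \<notin> Q" and disjQ: "disjoint Q"
      using Q by (auto simp: partition_on_def)
    have disj: "X = Y" if "X \<in> Q" "Y \<in> Q" "z \<in> X" "z \<in> Y" for X Y z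
      using disjQ that unfolding disjoint_def by blast
    have nsing: "{u} \<notin> Q" "{v} \<notin> Q" using Q by auto
    obtain X Y where X: "X \<in> Q" "u \<in> X" and Y: "Y \<in> Q" "v \<in> Y" using U by blast
    have sel: "{Z \<in> Q. u \<in> Z} = {X}" "{Z \<in> Q. v \<in> Z} = {Y}"
      using X Y disj by blast+
    have XY: "X \<subseteq> insert u (insert v A)" "Y \<subseteq> insert u (insert v A)" using X Y U by blast+
    define R where "R = {Z \<in> Q. Z \<subseteq> A}"
    have QR: "Q = insert X (insert Y R)"
    proof
      show "Q \<subseteq> insert X (insert Y R)"
      proof
        fix Z assume Z: "Z \<in> Q"
        then have "Z \<subseteq> insert u (insert v A)" using U by auto
        then have "Z \<subseteq> A" if "u \<notin> Z" "v \<notin> Z" using that by blast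
        then show "Z \<in> insert X (insert Y R)" using Z sel unfolding R_def by blast
      qed
    qed (use X Y R_def in blast)
    have XR: "Z \<inter> X = {}" "Z \<inter> Y = {}" if "Z \<in> R" for Z
      using that X Y uv disj unfolding R_def by blast+
    have "partition_on (A - (X \<union> Y)) R"
    proof (rule partition_onI)
      show "\<Union>R = A - (X \<union> Y)"
      proof
        show "\<Union>R \<subseteq> A - (X \<union> Y)" using XR by (auto simp: R_def)
        have "\<Union>Q = X \<union> Y \<union> \<Union>R" unfolding QR by blast
        then show "A - (X \<union> Y) \<subseteq> \<Union>R" using U by blast
      qed
      show "{} \<notin> R" using ne by (auto simp: R_def)
      show "disjnt p q" if "p \<in> R" "q \<in> R" "p \<noteq> q" for p q
        using that disjQ unfolding disjnt_def disjoint_def R_def by blast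
    qed
    moreover have "A - (X \<inter> A \<union> (Y \<inter> A - X \<inter> A)) = A - (X \<union> Y)" by blast
    ultimately have R: "partition_on (A - (X \<inter> A \<union> (Y \<inter> A - X \<inter> A))) R" by simp
    have gQ: "g Q = (X \<inter> A, Y \<inter> A - X \<inter> A, R)" by (simp add: g_def sel R_def Let_def)
    show ?thesis
    proof (cases "X = Y")
      case True
      then have "insert u (insert v (X \<inter> A)) = X" using X Y XY by blast
      then show ?thesis using R QR True unfolding gQ by (auto simp: split_partitions_def)
    next
      case False
      then have dXY: "X \<inter> Y = {}" using X Y disj by blast
      then have eqs: "insert u (X \<inter> A) = X" "insert v (Y \<inter> A) = Y" "Y \<inter> A - X \<inter> A = Y \<inter> A"
        using X Y XY by blast+
      \<comment> \<open>The absence of \<open>{u}\<close> and \<open>{v}\<close> makes both traces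
        on \<open>A\<close> nonempty: the triple is admissible, and the map takes its two-block
        branch.\<close>
      then have "X \<inter> A \<noteq> {}" "Y \<inter> A \<noteq> {}" using nsing X(1) Y(1) by auto
      then show ?thesis
        using R QR dXY eqs unfolding gQ by (auto simp: split_partitions_def)
    qed
  qed
  show ?thesis
  proof (rule bij_betw_inverseI[where g = g])
    fix p assume "p \<in> split_partitions A"
    then show "?f p \<in> ?B \<and> g (?f p) = p" by (cases p) (simp only: f)
  qed (fact g)
qed

section \<open>Adjoining the singleton block and conclusion\<close>

lemma bij_betw_insert_singleton_block:
  assumes "w \<notin> A"
  shows "bij_betw (insert {w}) {Q. partition_on A Q \<and> \<Phi> Q}
           {P. partition_on (insert w A) P \<and> {w} \<in> P \<and> \<Phi> (P - {{w}})}"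
\<comment> \<open>Deleting \<open>{w}\<close> undoes its insertion because
  \<open>w \<notin> A\<close> keeps it from being a block of \<open>Q\<close>. Testing
  \<open>\<Phi>\<close> on \<open>P - {{w}}\<close> makes it the same condition on both
  sides.\<close>
proof (rule bij_betw_byWitness[where f' = "\<lambda>P. P - {{w}}"])
  have new: "{w} \<notin> Q" if "partition_on A Q" for Q
    using that assms by (auto simp: partition_on_def)
  then show "\<forall>Q\<in>{Q. partition_on A Q \<and> \<Phi> Q}. insert {w} Q - {{w}} = Q" by auto
  show "\<forall>P\<in>{P. partition_on (insert w A) P \<and> {w} \<in> P \<and> \<Phi> (P - {{w}})}.
      insert {w} (P - {{w}}) = P" by auto
  have "partition_on (insert w A) (insert {w} Q)" if "partition_on A Q" for Q
    using that assms unfolding partition_on_def disjoint_def by blast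
  with new show "insert {w} ` {Q. partition_on A Q \<and> \<Phi> Q}
      \<subseteq> {P. partition_on (insert w A) P \<and> {w} \<in> P \<and> \<Phi> (P - {{w}})}" by auto
  have "partition_on A (P - {{w}})" if P: "partition_on (insert w A) P" and w: "{w} \<in> P" for P
  proof -
    have "disjnt {w} (\<Union>(P - {{w}}))"
      using disjointD[OF partition_onD2[OF P] w] by (fastforce simp: disjnt_iff)
    moreover have "insert {w} (P - {{w}}) = P" using w by blast
    ultimately have "partition_on (insert w A - {w}) (P - {{w}})"
      using P partition_on_insert by metis
    then show ?thesis using assms by simp
  qed
  then show "(\<lambda>P. P - {{w}}) ` {P. partition_on (insert w A) P \<and> {w} \<in> P \<and> \<Phi> (P - {{w}})}
      \<subseteq> {Q. partition_on A Q \<and> \<Phi> Q}" by auto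
qed

text \<open>Only \<open>n + 2\<close> and \<open>n + 3\<close> exceed \<open>n + 1\<close> in the
  ground set, so maximality of \<open>n + 1\<close> just forbids these two as singletons.\<close>

lemma partitions_max_singleton_add_3:
  "partitions_max_singleton (n + 3) (n + 1) =
     {P. partition_on {1..n+3} P \<and> {n+1} \<in> P \<and> {n+2} \<notin> P \<and> {n+3} \<notin> P}"
proof -
  have "singleton_elements P \<noteq> {} \<and> Max (singleton_elements P) = n + 1 \<longleftrightarrow>
      {n+1} \<in> P \<and> {n+2} \<notin> P \<and> {n+3} \<notin> P" if P: "partition_on {1..n+3} P" for P
  proof -
    have sub: "singleton_elements P \<subseteq> {1..n+3}"
      using P by (auto simp: singleton_elements_def partition_on_def)
    then have fin: "finite (singleton_elements P)" by (rule finite_subset) simp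
    have *: "k \<le> n + 1 \<or> k = n + 2 \<or> k = n + 3" if "k \<in> singleton_elements P" for k
      using sub that by force
    have "singleton_elements P \<noteq> {} \<and> Max (singleton_elements P) = n + 1 \<longleftrightarrow>
        n + 1 \<in> singleton_elements P \<and> (\<forall>k \<in> singleton_elements P. k \<le> n + 1)"
      using fin by (metis Max_eq_iff empty_iff)
    also have "\<dots> \<longleftrightarrow> n + 1 \<in> singleton_elements P \<and>
        n + 2 \<notin> singleton_elements P \<and> n + 3 \<notin> singleton_elements P"
      using * by force
    finally show ?thesis by (simp add: singleton_elements_def)
  qed
  then show ?thesis by (auto simp: partitions_max_singleton_def)
qed

theorem theorem3p1:
  fixes n :: nat
  assumes "n \<ge> 1"
  shows "\<exists>f. bij_betw f (eq_avoiders_1a2a n) (partitions_max_singleton (n + 3) (n + 1))"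
proof -
  let ?A = "insert (n+2) (insert (n+3) {1..n})"
  \<comment> \<open>The point \<open>n + 1\<close> is split off first, leaving \<open>[n]\<close>
    with \<open>u = n + 2\<close> and \<open>v = n + 3\<close>.\<close>
  have "{1..n+3} = insert (n+1) ?A" by auto
  \<comment> \<open>Deleting \<open>{n+1}\<close> does not affect whether \<open>{n+2}\<close> or
    \<open>{n+3}\<close> is a block; this form matches \<Phi>.\<close>
  then have "partitions_max_singleton (n + 3) (n + 1) =
      {P. partition_on (insert (n+1) ?A) P \<and> {n+1} \<in> P \<and>
          ({n+2} \<notin> P - {{n+1}} \<and> {n+3} \<notin> P - {{n+1}})}"
    unfolding partitions_max_singleton_add_3 by auto
  then have "bij_betw (insert {n+1}) {Q. partition_on ?A Q \<and> {n+2} \<notin> Q \<and> {n+3} \<notin> Q}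
      (partitions_max_singleton (n + 3) (n + 1))"
    using bij_betw_insert_singleton_block[of "n+1" ?A "\<lambda>Q. {n+2} \<notin> Q \<and> {n+3} \<notin> Q"] by simp
  moreover have "\<exists>f. bij_betw f (split_partitions {1..n})
      {Q. partition_on ?A Q \<and> {n+2} \<notin> Q \<and> {n+3} \<notin> Q}"
    using bij_betw_split_partitions[of "n+2" "{1..n}" "n+3"] by auto
  ultimately show ?thesis
    using bij_betw_eq_avoiders_1a2a[of n] by (meson bij_betw_trans)
qed

end
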